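(* Let $c=9.71$ and, for each $n$, let $\textsc{Onl}$ be the algorithm (described in the context) with thresholds $\delta_{p(i)}$ where $p(i)=e^{-\frac{ci}{n^2}}$. Then \[\liminf_{n\to\infty}\ \inf_D\ \frac{\mathbb{E}[\textsc{Onl}_n]}{\mathbb{E}[\textsc{Opt}_n]}\ \ge\ 0.598,\] where $D$ ranges over all distributions allowed in the model; i.e., $\textsc{Onl}$ gives a lower bound of $0.598$ on the prophet-inequality over time for $n\to\infty$.
   Context: Model (prophet-inequality over time). Fix $n\in\mathbb{N}_{>0}$ and a continuous distribution $D$ with density and cumulative distribution function $F$, supported on non-negative numbers ($F(0)=0$), with finite expectation. Random variables $x_1,\dots,x_n$ are i.i.d. with distribution $D$ and revealed one by one. In step $i$, if step $i$ is not covered by an earlier selection, the decider chooses $t_i\in\{1,\dots,n-i+1\}$ and gains $x_i$ for $t_i$ steps (steps $i,\dots,i+t_i-1$ become covered); if step $i$ is covered (i.e. $i\le j+t_j-1$ for some $j<i$), then $t_i=0$. The total value is $\sum_i x_it_i$. $\textsc{Opt}_n$ is the maximum of $\sum_i x_it_i$ over all feasible choices made with full knowledge of $x_1,\dots,x_n$; $\mathbb{E}[\textsc{Opt}_n]$ is its expectation. For $p\in[0,1]$, $\delta_p$ denotes a value with $\Pr_{x\sim D}[x\le\delta_p]=p$. The algorithm $\textsc{Onl}$ with thresholds $\delta_{p(1)},\dots,\delta_{p(n)}$: for $i=1,\dots,n$, if $x_i>\delta_{p(i)}$, select $x_i$ for all $n-i+1$ remaining steps and stop; otherwise select $x_i$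 only in step $i$ ($t_i=1$). $\mathbb{E}[\textsc{Onl}_n]$ is its expected total value. *)

theory Defs
  imports "HOL-Probability.Probability"
begin

definition prophet_dist :: "real measure \<Rightarrow> bool" where
  "prophet_dist D \<longleftrightarrow>
     real_distribution D \<and>
     (\<exists>f \<in> borel_measurable lborel. D = density lborel f) \<and>
     cdf D 0 = 0 \<and>
     integrable D (\<lambda>x. x)"

text \<open>
  Steps are numbered \<open>1, ..., n\<close>, and \<open>t i\<close> is the number of steps for which the value
  revealed in step \<open>i\<close> is selected. The condition \<open>i < j + t j\<close> is \<open>i \<le> j + t j - 1\<close>
  without truncated subtraction. Choices are extensional functions, so that there are
  only finitely many feasible ones.
\<close>

definition covered :: "(nat \<Rightarrow> nat) \<Rightarrow> nat \<Rightarrow> bool" where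
  "covered t i \<longleftrightarrow> (\<exists>j\<in>{1..<i}. i < j + t j)"

definition feasible :: "nat \<Rightarrow> (nat \<Rightarrow> nat) set" where
  "feasible n = {t \<in> extensional {1..n}.
     \<forall>i\<in>{1..n}. if covered t i then t i = 0 else t i \<in> {1..n - i + 1}}"

definition total_value :: "nat \<Rightarrow> (nat \<Rightarrow> real) \<Rightarrow> (nat \<Rightarrow> nat) \<Rightarrow> real" where
  "total_value n x t = (\<Sum>i\<in>{1..n}. x i * real (t i))"

definition opt :: "nat \<Rightarrow> (nat \<Rightarrow> real) \<Rightarrow> real" where
  "opt n x = Max (total_value n x ` feasible n)"

text \<open>
  The online algorithm with threshold \<open>\<theta> i\<close> in step \<open>i\<close>. A step is covered by an earlier
  selection exactly when some earlier value exceeded its threshold: the first such value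
  was selected for all remaining steps, and every selection before it for one step only.
\<close>

definition onl_choice :: "nat \<Rightarrow> (nat \<Rightarrow> real) \<Rightarrow> (nat \<Rightarrow> real) \<Rightarrow> nat \<Rightarrow> nat" where
  "onl_choice n \<theta> x = (\<lambda>i\<in>{1..n}.
     if \<exists>j\<in>{1..<i}. x j > \<theta> j then 0
     else if x i > \<theta> i then n - i + 1
     else 1)"

definition onl :: "nat \<Rightarrow> (nat \<Rightarrow> real) \<Rightarrow> (nat \<Rightarrow> real) \<Rightarrow> real" where
  "onl n \<theta> x = total_value n x (onl_choice n \<theta> x)"

abbreviation iid :: "nat \<Rightarrow> real measure \<Rightarrow> (nat \<Rightarrow> real) measure" where
  "iid n D \<equiv> Pi\<^sub>M {1..n} (\<lambda>_. D)"

definition E_opt :: "nat \<Rightarrow> real measure \<Rightarrow> real" where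
  "E_opt n D = (LINT x|iid n D. opt n x)"

definition E_onl :: "nat \<Rightarrow> (nat \<Rightarrow> real) \<Rightarrow> real measure \<Rightarrow> real" where
  "E_onl n \<theta> D = (LINT x|iid n D. onl n \<theta> x)"

text \<open>
  Thresholds \<open>\<delta> D p\<close> need not be unique; \<open>\<delta>\<close> is an arbitrary selection of them. The end
  points \<open>p = 0\<close> and \<open>p = 1\<close> are left out because no threshold need exist for \<open>p = 1\<close>
  and neither level is used by the algorithm.
\<close>

definition quantile_selection :: "(real measure \<Rightarrow> real \<Rightarrow> real) \<Rightarrow> bool" where
  "quantile_selection \<delta> \<longleftrightarrow>
     (\<forall>D p. prophet_dist D \<longrightarrow> 0 < p \<longrightarrow> p < 1 \<longrightarrow> cdf D (\<delta> D p) = p)"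

definition level :: "real \<Rightarrow> nat \<Rightarrow> nat \<Rightarrow> real" where
  "level c n i = exp (- (c * real i / (real n)\<^sup>2))"

lemma finite_feasible: "finite (feasible n)"
proof (rule finite_subset)
  show "feasible n \<subseteq> {1..n} \<rightarrow>\<^sub>E {0..n}"
  proof
    fix t assume t: "t \<in> feasible n"
    have "t i \<le> n" if i: "i \<in> {1..n}" for i
    proof -
      have "if covered t i then t i = 0 else t i \<in> {1..n - i + 1}"
        using t i unfolding feasible_def by blast
      then show ?thesis using i by (auto split: if_splits)
    qed
    then show "t \<in> {1..n} \<rightarrow>\<^sub>E {0..n}"
      using t by (auto simp: feasible_def PiE_iff)
  qed
qed (auto intro: finite_PiE)

lemma onl_choice_feasible: "onl_choice n \<theta> x \<in> feasible n"
proof -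
  have cov: "covered (onl_choice n \<theta> x) i \<longleftrightarrow> (\<exists>j\<in>{1..<i}. x j > \<theta> j)" if i: "i \<in> {1..n}" for i
  proof
    assume "covered (onl_choice n \<theta> x) i"
    then obtain j where j: "j \<in> {1..<i}" "i < j + onl_choice n \<theta> x j"
      by (auto simp: covered_def)
    then show "\<exists>j\<in>{1..<i}. x j > \<theta> j"
      using i by (auto simp: onl_choice_def split: if_splits intro!: bexI[of _ j])
  next
    assume "\<exists>j\<in>{1..<i}. x j > \<theta> j"
    then have ex: "\<exists>j. j \<in> {1..<i} \<and> x j > \<theta> j" by blast
    define j where "j = (LEAST j. j \<in> {1..<i} \<and> x j > \<theta> j)"
    have j: "j \<in> {1..<i}" "x j > \<theta> j"
      using LeastI_ex[OF ex] by (auto simp: j_def)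
    have "\<not> (\<exists>k\<in>{1..<j}. x k > \<theta> k)"
      using j(1) not_less_Least[of _ "\<lambda>j. j \<in> {1..<i} \<and> x j > \<theta> j", folded j_def] by fastforce
    then have "onl_choice n \<theta> x j = n - j + 1"
      using i j by (auto simp: onl_choice_def)
    then show "covered (onl_choice n \<theta> x) i"
      using i j by (auto simp: covered_def intro!: bexI[of _ j])
  qed
  show ?thesis
    unfolding feasible_def using cov by (auto simp: onl_choice_def)
qed

lemma feasible_nonempty: "feasible n \<noteq> {}"
  using onl_choice_feasible by blast

lemma quantile_exists:
  assumes D: "prophet_dist D" and p: "0 < p" "p < 1"
  shows "\<exists>d. cdf D d = p"
proof -
  interpret real_distribution D using D by (simp add: prophet_dist_def)
  obtain f where f: "f \<in> borel_measurable lborel" "D = density lborel f"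
    using D by (auto simp: prophet_dist_def)
  have "emeasure D {a} = 0" for a
    unfolding f(2) using f(1) by (subst emeasure_density) (auto intro!: nn_integral_null_set)
  then have cont: "isCont (cdf D) a" for a
    by (simp add: isCont_cdf measure_def)
  have "eventually (\<lambda>x. cdf D x < p) at_bot"
    using order_tendstoD(2)[OF cdf_lim_at_bot p(1)] .
  then obtain a where a: "\<And>x. x \<le> a \<Longrightarrow> cdf D x < p"
    by (auto simp: eventually_at_bot_linorder)
  have "eventually (\<lambda>x. cdf D x > p) at_top"
    using order_tendstoD(1)[OF cdf_lim_at_top_prob p(2)] .
  then obtain b where b: "\<And>x. x \<ge> b \<Longrightarrow> cdf D x > p"
    by (auto simp: eventually_at_top_linorder)
  have "cdf D a \<le> p" "p \<le> cdf D (max a b)"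
    using a[of a] b[of "max a b"] by auto
  then show ?thesis
    using IVT[of "cdf D" a p "max a b"] cont by auto
qed

lemma quantile_selection_exists: "\<exists>\<delta>. quantile_selection \<delta>"
proof
  show "quantile_selection (\<lambda>D p. SOME d. cdf D d = p)"
    unfolding quantile_selection_def using someI_ex[OF quantile_exists] by blast
qed

end

(*
  Let T(y) = P(x > y). By the layer-cake formula E[Onl] is the integral over y >= 0 of
    onl_tail(T(y)) = sum_i P_i ((n - i) min(T(y), 1 - p(i)) + T(y)),
  where P_i = p(1) ... p(i-1) = exp(-c i (i-1) / (2 n^2)) is the probability of reaching step i.
  The optimum gains in step k at most max(x_1, ..., x_k), so E[Opt] is at most the integral of
    opt_tail(T(y)) = sum_k (1 - (1 - T(y))^k).
  Hence it suffices that 0.598 opt_tail(u) <= onl_tail(u) for all u in [0,1] and all large n.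
  With a = n u, this follows for a <= 1.92 from the Bonferroni bound on opt_tail and a quadratic
  lower bound on onl_tail, and for a >= 1.92 by comparing onl_tail with its value at u = 1. The
  leading coefficients 0.2991 and 1 - 0.4017 come from the integrals over [0,1] of
  (1 - s) exp(-c s^2 / 2) and exp(-c s^2 / 2), which Taylor polynomials of exp bound.
*)
theory Submission
  imports Defs
begin

section \<open>Gaussian sums\<close>

text \<open>The Lagrange remainder has the sign of \<open>(-x) ^ N\<close>, so the parity of
  \<open>N\<close> decides on which side of \<open>exp (-x)\<close> the truncated series
  lies.\<close>

lemma exp_minus_Taylor:
  fixes x :: real
  assumes "x \<ge> 0"
  shows "even N \<Longrightarrow> (\<Sum>m<N. (-x) ^ m / fact m) \<le> exp (-x)"
    and "odd N \<Longrightarrow> exp (-x) \<le> (\<Sum>m<N. (-x) ^ m / fact m)"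
proof -
  obtain t where t: "exp (-x) = (\<Sum>m<N. (-x) ^ m / fact m) + exp t / fact N * (-x) ^ N"
    using Maclaurin_exp_le[of "-x" N] by blast
  show "(\<Sum>m<N. (-x) ^ m / fact m) \<le> exp (-x)" if "even N"
    unfolding t using that assms by simp
  show "exp (-x) \<le> (\<Sum>m<N. (-x) ^ m / fact m)" if "odd N"
    unfolding t using that assms by simp
qed

text \<open>Termwise integration; it reduces bounds on Gaussian integrals to finite sums.\<close>

lemma integral_gauss_Taylor:
  fixes k :: real
  shows "((\<lambda>s. \<Sum>m<N. (- (k * s\<^sup>2)) ^ m / fact m) has_integral
          (\<Sum>m<N. (-k) ^ m / (fact m * (2 * real m + 1)))) {0..1}"
proof (rule has_integral_sum)
  fix m
  have "((\<lambda>s. s ^ (2 * m)) has_integral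
      1 ^ Suc (2 * m) / real (Suc (2 * m)) - 0 ^ Suc (2 * m) / real (Suc (2 * m))) {0..1::real}"
    by (rule fundamental_theorem_of_calculus)
      (auto intro!: derivative_eq_intros simp flip: has_real_derivative_iff_has_vector_derivative
        simp del: power_Suc of_nat_Suc)
  from has_integral_mult_right[OF this, of "(-k) ^ m / fact m"]
  have "((\<lambda>s. (-k) ^ m / fact m * s ^ (2 * m)) has_integral
      (-k) ^ m / (fact m * (2 * real m + 1))) {0..1}"
    by (simp add: add.commute)
  moreover have "(- (k * s\<^sup>2)) ^ m = (-k) ^ m * s ^ (2 * m)" for s
    by (metis mult_minus_left power_mult power_mult_distrib)
  ultimately show "((\<lambda>s. (- (k * s\<^sup>2)) ^ m / fact m) has_integral
      (-k) ^ m / (fact m * (2 * real m + 1))) {0..1}"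
    by simp
qed simp

text \<open>The constant \<open>4.855\<close> is half of \<open>9.71\<close>. An even and an odd
  truncation of the series enclose the integral.\<close>

lemma integral_gauss_bounds:
  "integral {0..1} (\<lambda>s::real. exp (- (4.855 * s\<^sup>2))) \<in> {0.4013..0.4017}"
proof -
  let ?g = "\<lambda>s::real. exp (- (4.855 * s\<^sup>2))"
  have g: "(?g has_integral integral {0..1} ?g) {0..1}"
    by (intro integrable_integral integrable_continuous_real continuous_intros)
  have "(\<Sum>m<18. (-4.855) ^ m / (fact m * (2 * real m + 1))) \<le> integral {0..1} ?g"
    by (rule has_integral_le[OF integral_gauss_Taylor g]) (intro exp_minus_Taylor; simp)
  moreover have "integral {0..1} ?g \<le> (\<Sum>m<17. (-4.855) ^ m / (fact m * (2 * real m + 1)))"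
    by (rule has_integral_le[OF g integral_gauss_Taylor]) (intro exp_minus_Taylor; simp)
  ultimately show ?thesis
    by (simp add: lessThan_nat_numeral lessThan_Suc fact_numeral power_divide)
qed

text \<open>On each grid cell an antitone function lies between its values at the two ends. Allowing
  \<open>m\<close> of the \<open>n\<close> cells lets an induction add one cell at a time.\<close>

lemma antimono_Riemann_sum:
  fixes f :: "real \<Rightarrow> real" and n m :: nat
  assumes mono: "\<And>x y. 0 \<le> x \<Longrightarrow> x \<le> y \<Longrightarrow> y \<le> 1 \<Longrightarrow> f y \<le> f x"
    and cont: "continuous_on {0..1} f" and n: "n > 0"
  shows "m \<le> n \<Longrightarrow> n * integral {0..m/n} f \<le> (\<Sum>i<m. f (i/n))"
    and "m \<le> n \<Longrightarrow> (\<Sum>i<m. f (Suc i/n)) \<le> n * integral {0..m/n} f"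
proof -
  have int: "f integrable_on {a..b}" if "0 \<le> a" "b \<le> 1" for a b
    using that cont by (intro integrable_continuous_real) (auto elim: continuous_on_subset)
  have step: "integral {0..Suc i/n} f = integral {0..i/n} f + integral {i/n..Suc i/n} f"
    if "Suc i \<le> n" for i :: nat
    using that n int[of 0 "Suc i/n"]
    by (intro Henstock_Kurzweil_Integration.integral_combine[symmetric])
      (auto simp: field_simps)
  have up: "n * integral {i/n..Suc i/n} f \<le> f (i/n)" if "Suc i \<le> n" for i :: nat
  proof -
    have le: "Suc i/n \<le> 1" "i/n \<le> Suc i/n"
      using that n by (auto simp: field_simps)
    have "integral {i/n..Suc i/n} f \<le> integral {i/n..Suc i/n} (\<lambda>_. f (i/n))"
      using le by (intro integral_le int mono) auto
    also have "\<dots> = f (i/n) / n"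
      using n le by (simp add: field_simps)
    finally show ?thesis using n by (simp add: field_simps)
  qed
  have lo: "f (Suc i/n) \<le> n * integral {i/n..Suc i/n} f" if "Suc i \<le> n" for i :: nat
  proof -
    have le: "Suc i/n \<le> 1" "i/n \<le> Suc i/n"
      using that n by (auto simp: field_simps)
    have "f (Suc i/n) / n = integral {i/n..Suc i/n} (\<lambda>_. f (Suc i/n))"
      using n le by (simp add: field_simps)
    also have "\<dots> \<le> integral {i/n..Suc i/n} f"
      using le by (intro integral_le int mono) (auto intro: order_trans[of 0 "i/n"])
    finally show ?thesis using n by (simp add: field_simps)
  qed
  show "m \<le> n \<Longrightarrow> n * integral {0..m/n} f \<le> (\<Sum>i<m. f (i/n))"
  proof (induction m)
    case (Suc m)
    then show ?case using step[of m] up[of m] by (simp add: distrib_left)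
  qed simp
  show "m \<le> n \<Longrightarrow> (\<Sum>i<m. f (Suc i/n)) \<le> n * integral {0..m/n} f"
  proof (induction m)
    case (Suc m)
    then show ?case using step[of m] lo[of m] by (simp add: distrib_left)
  qed simp
qed

section \<open>Probabilities of reaching a step and their sums\<close>

text \<open>The exponents \<open>c * j / n\<^sup>2\<close> of the levels with \<open>j < i\<close>
  add up to this closed form; \<open>prod_level\<close> identifies it with the product.\<close>

definition reach :: "real \<Rightarrow> nat \<Rightarrow> nat \<Rightarrow> real" where
  "reach c n i = exp (- (c * (real i * (real i - 1)) / (2 * (real n)\<^sup>2)))"

lemma reach_Suc: "reach c n (Suc i) = reach c n i * level c n i"
  by (cases "n = 0") (auto simp: reach_def level_def field_simps simp flip: exp_add)

lemma prod_level: "i \<ge> 1 \<Longrightarrow> (\<Prod>j\<in>{1..<i}. level c n j) = reach c n i"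
proof (induction i rule: dec_induct)
  case base
  show ?case by (simp add: reach_def)
next
  case (step i)
  then show ?case by (simp add: reach_Suc)
qed

lemma reach_antimono:
  assumes "c \<ge> 0" "i \<le> j"
  shows "reach c n j \<le> reach c n i"
  using assms(2)
proof (induction j rule: dec_induct)
  case (step j)
  have "reach c n (Suc j) \<le> reach c n j"
    using assms(1) unfolding reach_Suc by (simp add: level_def reach_def)
  with step show ?case by simp
qed simp

text \<open>Here \<open>i * (i - 1) \<le> i\<^sup>2\<close>, and \<open>reach_Suc_le_gauss\<close>
  uses \<open>i\<^sup>2 \<le> (i + 1) * i\<close>. So the probabilities interlace with samples of
  the Gaussian, and both kinds of sums agree up to an index shift by one.\<close>

lemma gauss_le_reach: "exp (- (4.855 * (i/n)\<^sup>2)) \<le> reach 9.71 n i" for i n :: nat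
proof -
  have "9.71 * (real i * (real i - 1)) / (2 * (real n)\<^sup>2) \<le>
      9.71 * (real i)\<^sup>2 / (2 * (real n)\<^sup>2)"
    by (intro divide_right_mono) (auto simp: algebra_simps power2_eq_square)
  then show ?thesis
    by (simp add: reach_def power_divide)
qed

lemma reach_Suc_le_gauss: "reach 9.71 n (Suc i) \<le> exp (- (4.855 * (i/n)\<^sup>2))" for i n :: nat
proof -
  have "9.71 * (real i)\<^sup>2 / (2 * (real n)\<^sup>2) \<le>
      9.71 * (real (Suc i) * (real (Suc i) - 1)) / (2 * (real n)\<^sup>2)"
    by (intro divide_right_mono) (auto simp: algebra_simps power2_eq_square)
  then show ?thesis
    by (simp add: reach_def power_divide)
qed

text \<open>The index shift yields a left-end-point sum, which lies above the integral. Passing to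
  right end points telescopes and costs at most \<open>?g 0 = 1\<close>, the additive
  constant.\<close>

lemma sum_reach_le:
  assumes "n > 0"
  shows "(\<Sum>i\<in>{1..n}. reach 9.71 n i) \<le> 0.4017 * n + 1"
proof -
  let ?g = "\<lambda>s::real. exp (- (4.855 * s\<^sup>2))"
  have "(\<Sum>i\<in>{1..n}. reach 9.71 n i) = (\<Sum>i<n. reach 9.71 n (Suc i))"
    by (rule sum.reindex_bij_witness[of _ Suc "\<lambda>i. i - 1"]) auto
  also have "\<dots> \<le> (\<Sum>i<n. ?g (i/n))"
    by (intro sum_mono reach_Suc_le_gauss)
  also have "\<dots> \<le> (\<Sum>i<n. ?g (Suc i/n)) + 1"
  proof -
    have "(\<Sum>i<m. ?g (i/n)) = (\<Sum>i<m. ?g (Suc i/n)) + 1 - ?g (m/n)" for m :: nat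
      by (induction m) auto
    from this[of n] show ?thesis by simp
  qed
  also have "(\<Sum>i<n. ?g (Suc i/n)) \<le> n * integral {0..n/n} ?g"
    using assms by (intro antimono_Riemann_sum) (auto intro!: continuous_intros power_mono)
  also have "integral {0..n/n} ?g \<le> 0.4017"
    using integral_gauss_bounds assms by simp
  finally show ?thesis using assms by (simp add: mult.commute mult_left_mono)
qed

lemma sum_reach_weighted_ge:
  assumes "n > 0"
  shows "0.2991 * (real n)\<^sup>2 - n \<le> (\<Sum>i\<in>{1..n}. reach 9.71 n i * (real n - i))"
proof -
  let ?g = "\<lambda>s::real. exp (- (4.855 * s\<^sup>2))"
  let ?f = "\<lambda>s. (1 - s) * ?g s"
  \<comment> \<open>An antiderivative of \<open>s * ?g s\<close> is \<open>- ?g s / 9.71\<close>, so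
    only the integral of \<open>?g\<close> needs a numerical enclosure.\<close>
  have f: "(?f has_integral integral {0..1} ?g - (- (?g 1 / 9.71) - (- (?g 0 / 9.71)))) {0..1}"
  proof -
    have "((\<lambda>s. s * ?g s) has_integral (- (?g 1 / 9.71) - (- (?g 0 / 9.71)))) {0..1}"
      by (rule fundamental_theorem_of_calculus)
        (auto intro!: derivative_eq_intros simp flip: has_real_derivative_iff_has_vector_derivative)
    moreover have "(?g has_integral integral {0..1} ?g) {0..1}"
      by (intro integrable_integral integrable_continuous_real continuous_intros)
    ultimately show ?thesis
      using has_integral_diff[of ?g] by (simp add: left_diff_distrib)
  qed
  \<comment> \<open>The value \<open>?g 1\<close> enters the integral with weight
    \<open>1 / 9.71\<close>; without a positive lower bound on it, the enclosure of the Gaussian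
    integral would not give \<open>0.2991\<close>.\<close>
  have "(\<Sum>m<20. (-4.855) ^ m / fact m) \<le> exp (- (4.855::real))"
    using exp_minus_Taylor(1)[of "4.855" 20] by simp
  then have "0.0077 \<le> exp (- (4.855::real))"
    by (simp add: lessThan_nat_numeral lessThan_Suc fact_numeral power_divide)
  then have W: "0.2991 \<le> integral {0..1} ?f"
    using integral_gauss_bounds integral_unique[OF f] by simp
  have "n * 0.2991 \<le> n * integral {0..n/n} ?f"
    using W assms by simp
  also have "\<dots> \<le> (\<Sum>i<n. ?f (i/n))"
    using assms
    by (intro antimono_Riemann_sum mult_mono) (auto intro!: continuous_intros power_mono)
  \<comment> \<open>Since \<open>?f 0 = 1\<close> and \<open>?f 1 = 0\<close>, the shift to right
    end points costs exactly 1, which becomes the error \<open>n\<close> after scaling.\<close>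
  also have "\<dots> = (\<Sum>i<n. ?f (Suc i/n)) + 1"
  proof -
    have "(\<Sum>i<m. ?f (i/n)) = (\<Sum>i<m. ?f (Suc i/n)) + 1 - ?f (m/n)" for m :: nat
      by (induction m) auto
    from this[of n] show ?thesis using assms by simp
  qed
  also have "(\<Sum>i<n. ?f (Suc i/n)) = (\<Sum>i\<in>{1..n}. ?f (i/n))"
    by (rule sum.reindex_bij_witness[of _ "\<lambda>i. i - 1" Suc]) auto
  also have "\<dots> \<le> (\<Sum>i\<in>{1..n}. (1 - i/n) * reach 9.71 n i)"
    using assms by (intro sum_mono mult_left_mono gauss_le_reach) auto
  finally have "n * (n * 0.2991) \<le> n * ((\<Sum>i\<in>{1..n}. (1 - i/n) * reach 9.71 n i) + 1)"
    by (intro mult_left_mono) auto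
  also have "\<dots> = (\<Sum>i\<in>{1..n}. reach 9.71 n i * (real n - i)) + n"
    using assms by (auto simp: distrib_left sum_distrib_left field_simps intro!: sum.cong)
  finally show ?thesis
    by (simp add: power2_eq_square mult_ac)
qed

section \<open>Comparison of the layer-cake integrands\<close>

text \<open>The value of a reached step counts once in any case, hence \<open>+ u\<close>, and
  \<open>n - i\<close> further times if it exceeds its threshold, hence the \<open>min\<close> of
  two tail probabilities.\<close>

definition onl_tail :: "nat \<Rightarrow> real \<Rightarrow> real" where
  "onl_tail n u =
     (\<Sum>i\<in>{1..n}. reach 9.71 n i * ((real n - i) * min u (1 - level 9.71 n i) + u))"

definition opt_tail :: "nat \<Rightarrow> real \<Rightarrow> real" where
  "opt_tail n u = (\<Sum>k\<in>{1..n}. 1 - (1 - u) ^ k)"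

lemma reach_nonneg: "0 \<le> reach c n i"
  by (simp add: reach_def)

lemma reach_le_1: "c \<ge> 0 \<Longrightarrow> i \<ge> 1 \<Longrightarrow> reach c n i \<le> 1"
  using reach_antimono[of c 1 i n] by (simp add: reach_def)

section \<open>Bounds for small \<open>n * u\<close>\<close>

text \<open>The triangle of height \<open>u\<close> and slope \<open>d\<close> has area
  \<open>u\<^sup>2 / (2 * d)\<close>, and the sum takes its right end points.\<close>

lemma sum_pos_part_le:
  fixes u d :: real
  assumes "d > 0" "u \<ge> 0"
  shows "(\<Sum>i\<in>{1..m}. max 0 (u - d * real i)) \<le> u\<^sup>2 / (2 * d)"
proof -
  \<comment> \<open>Strengthened for the induction: the area of the triangle left beyond
    \<open>m\<close> is subtracted.\<close>
  have "(\<Sum>i\<in>{1..m}. max 0 (u - d * real i)) \<le> (u\<^sup>2 - (max 0 (u - d * real m))\<^sup>2) / (2 * d)"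
  proof (induction m)
    case 0
    then show ?case using assms by simp
  next
    case (Suc m)
    define M where "M = max 0 (u - d * real m)"
    define M' where "M' = max 0 (u - d * real (Suc m))"
    have "2 * d * M' \<le> M\<^sup>2 - M'\<^sup>2"
    proof (cases "u - d * real (Suc m) \<le> 0")
      case True
      then show ?thesis by (simp add: M'_def)
    next
      case False
      then have "M = M' + d"
        using assms by (auto simp: M_def M'_def max_def algebra_simps)
      then show ?thesis
        by (simp add: power2_eq_square algebra_simps)
    qed
    then have "M' \<le> (M\<^sup>2 - M'\<^sup>2) / (2 * d)"
      using assms by (simp add: field_simps)
    moreover have "(\<Sum>i\<in>{1..m}. max 0 (u - d * real i)) \<le> (u\<^sup>2 - M\<^sup>2) / (2 * d)"
      using Suc by (simp add: M_def)
    ultimately have "(\<Sum>i\<in>{1..m}. max 0 (u - d * real i)) + M' \<le> (u\<^sup>2 - M'\<^sup>2) / (2 * d)"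
      by (simp add: diff_divide_distrib)
    then show ?case by (simp add: M'_def)
  qed
  also have "\<dots> \<le> u\<^sup>2 / (2 * d)"
    using assms by (intro divide_right_mono) auto
  finally show ?thesis .
qed

lemma one_minus_level_le: "1 - level c n i \<le> c * i / (real n)\<^sup>2"
  using exp_ge_add_one_self[of "- (c * real i / (real n)\<^sup>2)"] by (simp add: level_def)

text \<open>From \<open>1 - exp (-x) \<ge> x - x\<^sup>2 / 2\<close> and
  \<open>x \<le> c / n\<close>. The bound is linear in \<open>i\<close>, as
  \<open>sum_pos_part_le\<close> requires.\<close>

lemma one_minus_level_ge:
  assumes "c \<ge> 0" "i \<le> n"
  shows "c * (1 - c / (2 * real n)) / (real n)\<^sup>2 * i \<le> 1 - level c n i"
proof -
  define x where "x = c * real i / (real n)\<^sup>2"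
  have "x \<ge> 0" using assms by (simp add: x_def)
  have "x \<le> c * real n / (real n)\<^sup>2"
    unfolding x_def using assms by (intro divide_right_mono mult_left_mono) auto
  also have "\<dots> = c / n"
    by (simp add: power2_eq_square)
  finally have "x * x \<le> x * (c / n)"
    using \<open>x \<ge> 0\<close> by (intro mult_left_mono)
  moreover have "exp (-x) \<le> 1 - x + x * x / 2"
    using exp_minus_Taylor(2)[of x 3] \<open>x \<ge> 0\<close>
    by (simp add: lessThan_nat_numeral lessThan_Suc power2_eq_square)
  moreover have "c * (1 - c / (2 * real n)) / (real n)\<^sup>2 * i = x * (1 - c / (2 * real n))"
    by (simp add: x_def)
  ultimately show ?thesis
    by (simp add: level_def x_def[symmetric] algebra_simps)
qed

text \<open>Here \<open>min u q\<close> is bounded below by \<open>u - max 0 (u - q)\<close>, and the weights of the second part by \<open>n\<close>.\<close>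

lemma onl_tail_ge_small:
  assumes "n \<ge> 10" "0 \<le> u"
  shows "u * (0.2991 * (real n)\<^sup>2 - n) - real n ^ 3 * u\<^sup>2 / (2 * (9.71 * (1 - 9.71 / (2 * real n)))) \<le> onl_tail n u"
proof -
  \<comment> \<open>The slope from \<open>one_minus_level_ge\<close>; it is positive because
    \<open>n \<ge> 10\<close>.\<close>
  define d where "d = 9.71 * (1 - 9.71 / (2 * real n)) / (real n)\<^sup>2"
  have d: "d > 0"
    using assms by (auto simp: d_def field_simps)
  have summand_le: "reach 9.71 n i * (real n - i) * u - n * max 0 (u - d * i) \<le>
      reach 9.71 n i * ((real n - i) * min u (1 - level 9.71 n i) + u)" if i: "i \<in> {1..n}" for i
  proof -
    let ?q = "1 - level 9.71 n i"
    have "d * i \<le> ?q"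
      using one_minus_level_ge[of "9.71" i n] i by (simp add: d_def)
    then have "max 0 (u - ?q) \<le> max 0 (u - d * i)"
      by auto
    then have "(reach 9.71 n i * (real n - i)) * max 0 (u - ?q) \<le> (1 * real n) * max 0 (u - d * i)"
      using i by (intro mult_mono) (auto simp: reach_nonneg reach_le_1)
    moreover have min: "min u ?q = u - max 0 (u - ?q)"
      by auto
    have "reach 9.71 n i * ((real n - i) * min u ?q + u) = reach 9.71 n i * (real n - i) * u -
        (reach 9.71 n i * (real n - i)) * max 0 (u - ?q) + reach 9.71 n i * u"
      unfolding min by (simp only: ring_distribs mult_ac)
    moreover have "0 \<le> reach 9.71 n i * u"
      using assms by (simp add: reach_nonneg)
    ultimately show ?thesis
      by simp
  qed
  have "u * (0.2991 * (real n)\<^sup>2 - n) - n * (u\<^sup>2 / (2 * d)) \<le>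
      u * (\<Sum>i\<in>{1..n}. reach 9.71 n i * (real n - i)) - n * (\<Sum>i\<in>{1..n}. max 0 (u - d * i))"
    using assms d by (intro diff_mono mult_left_mono sum_reach_weighted_ge sum_pos_part_le) auto
  also have "\<dots> = (\<Sum>i\<in>{1..n}. reach 9.71 n i * (real n - i) * u - n * max 0 (u - d * i))"
    by (simp add: sum_subtractf sum_distrib_left mult_ac)
  also have "\<dots> \<le> onl_tail n u"
    unfolding onl_tail_def by (intro sum_mono summand_le)
  also have "n * (u\<^sup>2 / (2 * d)) = real n ^ 3 * u\<^sup>2 / (2 * (9.71 * (1 - 9.71 / (2 * real n))))"
    by (simp add: d_def power2_eq_square power3_eq_cube)
  finally show ?thesis by simp
qed

text \<open>Truncations of the binomial expansion alternate around \<open>(1 - u) ^ k\<close>. By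
  \<open>(1 - u) ^ Suc k = (1 - u) ^ k - u * (1 - u) ^ k\<close>, each follows by induction from the
  one of lower degree, starting with Bernoulli's inequality.\<close>

lemma Bonferroni_power:
  fixes u :: real
  assumes "0 \<le> u" "u \<le> 1"
  shows "(1 - u) ^ k \<le> 1 - k * u + k * (real k - 1) / 2 * u\<^sup>2"
    and "1 - k * u + k * (real k - 1) / 2 * u\<^sup>2 - k * (real k - 1) * (real k - 2) / 6 * u ^ 3 \<le> (1 - u) ^ k"
proof -
  have lin: "1 - k * u \<le> (1 - u) ^ k" for k
    using Bernoulli_inequality[of "-u" k] assms by simp
  show quad: "(1 - u) ^ k \<le> 1 - k * u + k * (real k - 1) / 2 * u\<^sup>2" for k
  proof (induction k)
    case (Suc k)
    have "u * (1 - k * u) \<le> u * (1 - u) ^ k"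
      using lin assms by (intro mult_left_mono)
    with Suc show ?case
      by (simp add: algebra_simps power2_eq_square add_divide_distrib diff_divide_distrib)
  qed simp
  show "1 - k * u + k * (real k - 1) / 2 * u\<^sup>2 - k * (real k - 1) * (real k - 2) / 6 * u ^ 3 \<le> (1 - u) ^ k"
  proof (induction k)
    case (Suc k)
    have "u * (1 - u) ^ k \<le> u * (1 - k * u + k * (real k - 1) / 2 * u\<^sup>2)"
      using quad assms by (intro mult_left_mono)
    with Suc show ?case
      by (simp add: algebra_simps power2_eq_square power3_eq_cube add_divide_distrib diff_divide_distrib)
  qed simp
qed

text \<open>Summing the cubic bound over \<open>k\<close> is the hockey-stick identity: the
  coefficients are the binomials of \<open>n + 1\<close> over 2, 3 and 4.\<close>

lemma opt_tail_le_small: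
  assumes "0 \<le> u" "u \<le> 1"
  shows "opt_tail n u \<le> n * (real n + 1) / 2 * u - (real n + 1) * n * (real n - 1) / 6 * u\<^sup>2
      + (real n + 1) * n * (real n - 1) * (real n - 2) / 24 * u ^ 3"
proof -
  have "opt_tail n u \<le> (\<Sum>k\<in>{1..n}. k * u - k * (real k - 1) / 2 * u\<^sup>2
      + k * (real k - 1) * (real k - 2) / 6 * u ^ 3)"
    unfolding opt_tail_def using Bonferroni_power(2)[OF assms] by (intro sum_mono) (simp add: algebra_simps)
  also have "\<dots> = n * (real n + 1) / 2 * u - (real n + 1) * n * (real n - 1) / 6 * u\<^sup>2
      + (real n + 1) * n * (real n - 1) * (real n - 2) / 24 * u ^ 3"
    by (induction n) (auto simp: field_simps)
  finally show ?thesis .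
qed

text \<open>
  The bounds for small and for large \<open>n * u\<close> overlap only in a tiny interval around \<open>1.92\<close>.
\<close>

lemma tail_small:
  assumes n: "n \<ge> 100000" and u: "0 \<le> u" "n * u \<le> 1.92"
  shows "0.598 * opt_tail n u \<le> onl_tail n u"
proof -
  define a where "a = n * u"
  \<comment> \<open>In terms of \<open>a\<close> and \<open>e\<close> both sides are
    \<open>n\<close> times a polynomial in \<open>a\<close>, up to errors of order
    \<open>e\<close>.\<close>
  define e where "e = 1 / real n"
  have e: "0 < e" "e \<le> 0.00001" and a: "0 \<le> a" "a \<le> 1.92"
    using assms by (auto simp: a_def e_def field_simps)
  have ua: "u = a * e"
    using n by (auto simp: e_def a_def)
  have u1: "u \<le> 1"
    using mult_mono[of a "1.92" e "0.00001"] a e by (simp add: ua)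
  have "0.598 * opt_tail n u \<le> 0.598 * (n * (a * (1 + e) / 2 - a\<^sup>2 * (1 - e\<^sup>2) / 6 + a ^ 3 / 24))"
  proof -
    have "(real n + 1) * n * (real n - 1) * (real n - 2) / 24 * u ^ 3
        = ((1 + e) * (1 - e) * (1 - 2 * e)) * (n * a ^ 3 / 24)"
      using n by (simp add: e_def a_def field_simps power3_eq_cube)
    also have "\<dots> \<le> 1 * (n * a ^ 3 / 24)"
    proof (intro mult_right_mono)
      have "(1 + e) * (1 - e) \<le> 1" by (simp add: algebra_simps)
      then have "(1 + e) * (1 - e) * (1 - 2 * e) \<le> 1 * 1"
        using e by (intro mult_mono) auto
      then show "(1 + e) * (1 - e) * (1 - 2 * e) \<le> 1" by simp
    qed (use a in auto)
    finally have "opt_tail n u \<le> n * (real n + 1) / 2 * u - (real n + 1) * n * (real n - 1) / 6 * u\<^sup>2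
        + n * a ^ 3 / 24"
      using opt_tail_le_small[OF u(1) u1, of n] by simp
    also have "\<dots> = n * (a * (1 + e) / 2 - a\<^sup>2 * (1 - e\<^sup>2) / 6 + a ^ 3 / 24)"
      using n by (simp add: e_def a_def field_simps power3_eq_cube power2_eq_square)
    finally show ?thesis by simp
  qed
  \<comment> \<open>After division by \<open>n * a\<close>, the constant part has slack
    \<open>0.0001\<close> against an error of about \<open>1.3 * e\<close>. The part linear in
    \<open>a\<close> stays nonnegative up to \<open>a\<close> near \<open>1.933\<close>, which is
    why the case split at \<open>1.92\<close> works.\<close>
  also have "\<dots> \<le> n * (a * (0.2991 - e) - a\<^sup>2 * 0.0515)"
  proof -
    have "e\<^sup>2 \<le> 0.00001"
      using mult_mono[of e "0.00001" e 1] e by (simp add: power2_eq_square)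
    moreover have "0.598 / 24 * a \<le> 0.04784"
      using a by simp
    ultimately have "0 \<le> 0.598 * (1 - e\<^sup>2) / 6 - 0.0515 - 0.598 / 24 * a"
      by (simp add: field_simps)
    then have "0 \<le> (0.2991 - e - 0.299 * (1 + e)) + a * (0.598 * (1 - e\<^sup>2) / 6 - 0.0515 - 0.598 / 24 * a)"
      using e a by (intro add_nonneg_nonneg mult_nonneg_nonneg) auto
    then have "0 \<le> (n * a) * ((0.2991 - e - 0.299 * (1 + e)) + a * (0.598 * (1 - e\<^sup>2) / 6 - 0.0515 - 0.598 / 24 * a))"
      using a by (intro mult_nonneg_nonneg) auto
    then show ?thesis
      by (simp add: algebra_simps power2_eq_square power3_eq_cube add_divide_distrib diff_divide_distrib)
  qed
  also have "\<dots> \<le> u * (0.2991 * (real n)\<^sup>2 - n) - real n ^ 3 * u\<^sup>2 / (2 * (9.71 * (1 - 9.71 / (2 * real n))))"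
  proof -
    \<comment> \<open>The limit \<open>1 / 19.42\<close> is slightly below \<open>0.0515\<close>;
      the gap absorbs the correction of the slope.\<close>
    have "1 / (2 * (9.71 * (1 - 9.71 / (2 * real n)))) \<le> (0.0515::real)"
    proof -
      have "9.709 \<le> 9.71 * (1 - 9.71 / 2 * e)"
        using e by simp
      then have "1 / (2 * (9.71 * (1 - 9.71 / 2 * e))) \<le> (1 / (2 * 9.709)::real)"
        by (intro frac_le) auto
      then show ?thesis by (simp add: e_def)
    qed
    then have "(n * a\<^sup>2) * (1 / (2 * (9.71 * (1 - 9.71 / (2 * real n))))) \<le> (n * a\<^sup>2) * 0.0515"
      by (intro mult_left_mono) auto
    moreover have "real n ^ 3 * u\<^sup>2 = n * a\<^sup>2"
      by (simp add: a_def power2_eq_square power3_eq_cube)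
    moreover have "u * (0.2991 * (real n)\<^sup>2 - n) = n * (a * (0.2991 - e))"
      using n by (simp add: e_def a_def field_simps power2_eq_square)
    ultimately show ?thesis
      by (simp add: right_diff_distrib)
  qed
  also have "\<dots> \<le> onl_tail n u"
    using n u by (intro onl_tail_ge_small) auto
  finally show ?thesis .
qed

section \<open>Bounds for large \<open>n * u\<close>\<close>

text \<open>Summation by parts with \<open>reach c n 1 = 1\<close>. For a general upper limit
  \<open>m\<close> a boundary term with factor \<open>n - m\<close> remains, which vanishes at
  \<open>m = n\<close>.\<close>

lemma sum_reach_diff: "(\<Sum>i\<in>{1..n}. (reach c n i - reach c n (Suc i)) * (real n - i)) = n - (\<Sum>i\<in>{1..n}. reach c n i)"
proof -
  have "(\<Sum>i\<in>{1..m}. (reach c n i - reach c n (Suc i)) * (real n - i)) =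
      n - (\<Sum>i\<in>{1..m}. reach c n i) - reach c n (Suc m) * (real n - m)" for m
    by (induction m) (auto simp: algebra_simps reach_def)
  from this[of n] show ?thesis by simp
qed

text \<open>The left side is \<open>1 + r - (s + r / s)\<close>, and
  \<open>s + r / s \<ge> 2 * sqrt r\<close> by the inequality of means.\<close>

lemma product_le_sqrt:
  fixes r s :: real
  assumes "0 \<le> r" "0 < s"
  shows "(1 - s) * (1 - r / s) \<le> (1 - sqrt r)\<^sup>2"
proof -
  have "2 * sqrt r \<le> s + r / s"
  proof -
    have "0 \<le> (sqrt s - sqrt r / sqrt s)\<^sup>2" by simp
    also have "\<dots> = s + r / s - 2 * sqrt r"
      using assms by (simp add: power2_diff power_divide)
    finally show ?thesis by simp
  qed
  then show ?thesis
    using assms by (simp add: power2_diff algebra_simps diff_divide_distrib)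
qed

text \<open>
  Since \<open>reach i * (1 - level i) = reach i - reach (i + 1)\<close>, the sum for \<open>u = 1\<close> telescopes. Truncating
  at \<open>u\<close> loses the fraction \<open>1 - u / (1 - level i)\<close> of the summands with \<open>i / n > r\<close>, and
  \<open>(1 - s) (1 - r / s) \<le> (1 - sqrt r)\<^sup>2\<close> with \<open>s = i / n\<close>, so the total loss telescopes too.
\<close>

lemma onl_tail_ge_large:
  assumes n: "n \<ge> 1" and u: "0 \<le> u" and r: "r = n * u / 9.71"
  shows "n - (\<Sum>i\<in>{1..n}. reach 9.71 n i) -
     (if r \<le> 1 then n * (1 - sqrt r)\<^sup>2 * exp (- (9.71 * (r * (r - 1 / n)) / 2)) else 0) \<le> onl_tail n u"
proof -
  \<comment> \<open>This is the formula for \<open>reach\<close> at the possibly fractional position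
    \<open>r * n\<close>. Only steps beyond it can be truncated, so none are if
    \<open>r > 1\<close>.\<close>
  define M where "M = (if r \<le> 1 then exp (- (9.71 * (r * (r - 1 / n)) / 2)) else 0)"
  define N where "N = n * (1 - sqrt r)\<^sup>2"
  have r0: "0 \<le> r" and N: "0 \<le> N" and M: "0 \<le> M" using u by (auto simp: r N_def M_def)
  have summand_le: "(reach 9.71 n i - reach 9.71 n (Suc i)) * (real n - i) -
        N * (min (reach 9.71 n i) M - min (reach 9.71 n (Suc i)) M) \<le>
      reach 9.71 n i * ((real n - i) * min u (1 - level 9.71 n i) + u)" if i: "i \<in> {1..n}" for i
  proof -
    let ?R = "reach 9.71 n"
    let ?q = "1 - level 9.71 n i"
    have anti: "?R (Suc i) \<le> ?R i"
      by (intro reach_antimono) auto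
    have Rq: "?R i * ?q = ?R i - ?R (Suc i)"
      by (simp add: reach_Suc algebra_simps)
    \<comment> \<open>Capping at \<open>M\<close> confines the loss to truncated steps: there
      \<open>?R i \<le> M\<close>, so the capped difference is the full one, and elsewhere it is
      just nonnegative. The capped differences telescope to at most \<open>M\<close>.\<close>
    have "(real n - i) * (?R i * max 0 (?q - u)) \<le> N * (min (?R i) M - min (?R (Suc i)) M)"
    proof (cases "?q \<le> u")
      case True
      then show ?thesis using N anti by (auto intro!: mult_nonneg_nonneg)
    next
      case False
      define s where "s = i / real n"
      have s: "0 < s" "s \<le> 1" using i by (auto simp: s_def)
      have qs: "?q \<le> 9.71 * s / n"
        using one_minus_level_le[of "9.71" n i] by (simp add: s_def power2_eq_square)
      have ur: "u = 9.71 * r / n" using n by (simp add: r)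
      have "r < s"
        using False qs n by (simp add: ur field_simps)
      then have "r \<le> 1" using s by simp
      \<comment> \<open>The function \<open>x * (x - 1 / n)\<close> decreases near 0; the
        factorisation of the difference works because \<open>s \<ge> 1 / n\<close>.\<close>
      have "r * (r - 1 / n) \<le> s * (s - 1 / n)"
      proof -
        have "1 / n \<le> s"
          using i by (auto simp: s_def intro!: divide_right_mono)
        then have "0 \<le> (s - r) * (s + r - 1 / n)"
          using \<open>r < s\<close> r0 by (intro mult_nonneg_nonneg) auto
        then show ?thesis by (simp add: algebra_simps diff_divide_distrib)
      qed
      then have "?R i \<le> M"
        using n \<open>r \<le> 1\<close> by (simp add: reach_def M_def s_def field_simps power2_eq_square)
      then have min: "min (?R i) M = ?R i" "min (?R (Suc i)) M = ?R (Suc i)"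
        using anti by auto
      have q0: "0 < ?q" using False u by simp
      have "u / ?q \<ge> r / s"
      proof -
        have "r / s = u / (9.71 * s / n)"
          using n by (simp add: ur)
        also have "\<dots> \<le> u / ?q"
          using qs u by (rule divide_left_mono) (use s n q0 in \<open>intro mult_pos_pos; simp\<close>)
        finally show ?thesis .
      qed
      then have "(1 - s) * (1 - u / ?q) \<le> (1 - s) * (1 - r / s)"
        using s by (intro mult_left_mono) auto
      also have "\<dots> \<le> (1 - sqrt r)\<^sup>2"
        using r0 s by (intro product_le_sqrt)
      finally have "(?R i - ?R (Suc i)) * n * ((1 - s) * (1 - u / ?q)) \<le> (?R i - ?R (Suc i)) * n * (1 - sqrt r)\<^sup>2"
        using anti by (intro mult_left_mono) auto
      also have "(?R i - ?R (Suc i)) * n * ((1 - s) * (1 - u / ?q)) = (real n - i) * (?R i * max 0 (?q - u))"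
      proof -
        have q: "?q * (1 - u / ?q) = ?q - u" using q0 by (simp add: right_diff_distrib)
        have ns: "n * (1 - s) = real n - i" using n by (simp add: s_def right_diff_distrib)
        have "(?R i * ?q) * n * ((1 - s) * (1 - u / ?q)) =
            (n * (1 - s)) * (?R i * (?q * (1 - u / ?q)))"
          by (simp only: mult_ac)
        also have "\<dots> = (real n - i) * (?R i * (?q - u))"
          unfolding q ns ..
        finally have "(?R i * ?q) * n * ((1 - s) * (1 - u / ?q)) = (real n - i) * (?R i * (?q - u))" .
        moreover have "max 0 (?q - u) = ?q - u" using False by simp
        ultimately show ?thesis unfolding Rq by simp
      qed
      finally show ?thesis
        unfolding min N_def by (simp add: mult_ac)
    qed
    moreover have min: "min u ?q = ?q - max 0 (?q - u)"
      by auto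
    moreover have "0 \<le> ?R i * u" using u by (simp add: reach_nonneg)
    moreover have "(?R i - ?R (Suc i)) * (real n - i) = ?R i * ((real n - i) * ?q)"
      unfolding Rq[symmetric] by (simp only: mult_ac)
    moreover have "?R i * ((real n - i) * (?q - max 0 (?q - u)) + u) =
        ?R i * ((real n - i) * ?q) - (real n - i) * (?R i * max 0 (?q - u)) + ?R i * u"
      by (simp only: ring_distribs mult_ac)
    ultimately show ?thesis unfolding min by linarith
  qed
  have tele: "(\<Sum>i\<in>{1..m}. min (reach 9.71 n i) M - min (reach 9.71 n (Suc i)) M) =
      min (reach 9.71 n 1) M - min (reach 9.71 n (Suc m)) M" for m
    by (induction m) auto
  have "n - (\<Sum>i\<in>{1..n}. reach 9.71 n i) - N * M \<le>
     n - (\<Sum>i\<in>{1..n}. reach 9.71 n i) - N * (min (reach 9.71 n 1) M - min (reach 9.71 n (Suc n)) M)"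
    using N M reach_nonneg[of "9.71" n "Suc n"] by (intro diff_mono mult_left_mono) auto
  also have "\<dots> = (\<Sum>i\<in>{1..n}. (reach 9.71 n i - reach 9.71 n (Suc i)) * (real n - i) -
        N * (min (reach 9.71 n i) M - min (reach 9.71 n (Suc i)) M))"
    by (simp only: sum_subtractf sum_reach_diff sum_distrib_left[symmetric] flip: tele)
  also have "\<dots> \<le> onl_tail n u"
    unfolding onl_tail_def by (intro sum_mono summand_le)
  finally show ?thesis
    by (simp add: N_def M_def split: if_splits)
qed

text \<open>A geometric sum, followed by \<open>1 - u \<le> exp (-u)\<close>.\<close>

lemma opt_tail_le_large:
  assumes "0 < u" "u \<le> 1"
  shows "opt_tail n u \<le> n - (1 - u) * (1 - exp (- (n * u))) / u"
proof -
  have "opt_tail n u = n - (1 - u) * (1 - (1 - u) ^ n) / u"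
    unfolding opt_tail_def using assms by (induction n) (auto simp: field_simps)
  moreover have "(1 - u) ^ n \<le> exp (-u) ^ n"
    using assms exp_ge_add_one_self[of "-u"] by (intro power_mono) auto
  then have "(1 - u) ^ n \<le> exp (- (n * u))"
    by (simp flip: exp_of_nat_mult)
  then have "(1 - u) * (1 - exp (- (n * u))) / u \<le> (1 - u) * (1 - (1 - u) ^ n) / u"
    using assms by (intro divide_right_mono mult_left_mono) auto
  ultimately show ?thesis by simp
qed

text \<open>The slack \<open>0.0003 * n\<close> between \<open>0.5983 * n\<close> and
  \<open>0.598 * n\<close> absorbs the constant 1. It remains to bound the truncation loss by
  \<open>0.598 * h\<close>, and multiplying both by \<open>u\<close> makes them comparable to
  constants.\<close>

lemma tail_large:
  assumes n: "n \<ge> 100000" and u: "u \<le> 1" "n * u \<ge> 1.92"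
  shows "0.598 * opt_tail n u \<le> onl_tail n u"
proof -
  define a where "a = n * u"
  define r where "r = a / 9.71"
  define h where "h = (1 - u) * (1 - exp (- a)) / u"
  have u0: "u > 0"
    using u(2) mult_nonneg_nonpos[of "real n" u] by (cases "u \<le> 0") auto
  have h: "0 \<le> h"
    using u0 u by (auto simp: h_def a_def)
  have onl: "n * 0.5983 - 1 - (if r \<le> 1 then n * (1 - sqrt r)\<^sup>2 * exp (- (9.71 * (r * (r - 1 / n)) / 2)) else 0) \<le> onl_tail n u"
    using onl_tail_ge_large[of n u r] sum_reach_le[of n] n u0 by (simp add: r_def a_def)
  have opt: "opt_tail n u \<le> n - h"
    using opt_tail_le_large[of u n] u u0 by (simp add: h_def a_def)
  show ?thesis
  proof (cases "r \<le> 1")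
    case False
    then show ?thesis using onl opt h n by simp
  next
    case True
    have a: "1.92 \<le> a" "a \<le> 9.71" using u True by (auto simp: a_def r_def)
    have "exp (- a) \<le> exp (- 1.92)" using a by simp
    also have "\<dots> \<le> 0.15"
      using exp_minus_Taylor(2)[of "1.92" 9]
      by (simp add: lessThan_nat_numeral lessThan_Suc fact_numeral power_divide)
    finally have ea: "exp (- a) \<le> 0.15" .
    have "100000 * u \<le> a"
      unfolding a_def using n u0 by (intro mult_right_mono) auto
    then have "u \<le> 0.0001"
      using a by simp
    then have "0.9999 * 0.85 \<le> (1 - u) * (1 - exp (- a))"
      using ea by (intro mult_mono) auto
    then have H: "0.9999 * 0.85 \<le> u * h"
      using u0 by (simp add: h_def)
    have r0: "0.1977 \<le> r" using a by (simp add: r_def)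
    \<comment> \<open>Since \<open>1.92 / 9.71 > 0.19772\<close>, the exponent is at least
      \<open>0.1896\<close> in absolute value.\<close>
    have "exp (- (9.71 * (r * (r - 1 / n)) / 2)) \<le> exp (- 0.1896)"
    proof -
      have "1 / real n \<le> 0.00001" using n by (simp add: field_simps)
      then have "0.19772 * (0.19772 - 0.00001) \<le> r * (r - 1 / n)"
        using a by (intro mult_mono) (auto simp: r_def)
      then show ?thesis by simp
    qed
    also have "\<dots> \<le> 0.83"
      using exp_minus_Taylor(2)[of "0.1896" 5]
      by (simp add: lessThan_nat_numeral lessThan_Suc fact_numeral power_divide)
    finally have E: "exp (- (9.71 * (r * (r - 1 / n)) / 2)) \<le> 0.83" .
    have "(1 - sqrt r) * sqrt r \<le> 1 / 4"
      using zero_le_power2[of "sqrt r - 1/2"] by (simp add: power2_eq_square algebra_simps)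
    then have "((1 - sqrt r) * sqrt r)\<^sup>2 \<le> (1 / 4)\<^sup>2"
      using True r0 by (intro power_mono) auto
    then have Q: "(1 - sqrt r)\<^sup>2 * r \<le> 1 / 16"
      using r0 by (simp add: power_mult_distrib power_divide)
    have "u * (n * (1 - sqrt r)\<^sup>2 * exp (- (9.71 * (r * (r - 1 / n)) / 2))) =
        9.71 * ((1 - sqrt r)\<^sup>2 * r) * exp (- (9.71 * (r * (r - 1 / n)) / 2))"
      by (simp add: r_def a_def)
    also have "\<dots> \<le> 9.71 * (1 / 16) * 0.83"
      using Q E r0 by (intro mult_mono) auto
    also have "\<dots> \<le> u * (0.598 * h)"
      using H by simp
    finally have "n * (1 - sqrt r)\<^sup>2 * exp (- (9.71 * (r * (r - 1 / n)) / 2)) \<le> 0.598 * h"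
      using u0 by (simp only: mult_le_cancel_left_pos)
    then show ?thesis using onl opt n True by simp
  qed
qed

lemma tail_bound:
  assumes "n \<ge> 100000" "0 \<le> u" "u \<le> 1"
  shows "0.598 * opt_tail n u \<le> onl_tail n u"
  using tail_small[of n u] tail_large[of n u] assms by (cases "n * u \<le> 1.92") auto

section \<open>Expected values as layer-cake integrals\<close>

text \<open>A nonnegative \<open>X x\<close> is the length of the set of \<open>y \<ge> 0\<close>
  below it; Tonelli's theorem exchanges the two integrals.\<close>

lemma (in sigma_finite_measure) nn_integral_layer_cake:
  fixes X :: "'a \<Rightarrow> real"
  assumes [measurable]: "X \<in> borel_measurable M" and nonneg: "AE x in M. 0 \<le> X x"
  shows "(\<lambda>y. emeasure M {x \<in> space M. y < X x} * indicator {0..} y) \<in> borel_measurable lborel"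
    and "(\<integral>\<^sup>+ y. emeasure M {x \<in> space M. y < X x} * indicator {0..} y \<partial>lborel) = (\<integral>\<^sup>+ x. ennreal (X x) \<partial>M)"
proof -
  \<comment> \<open>Taken before the interpretation, as the fact about integrals over
    \<open>M\<close>.\<close>
  note measurable_integral = borel_measurable_nn_integral
  interpret pair_sigma_finite M lborel ..
  define h :: "'a \<Rightarrow> real \<Rightarrow> ennreal" where "h x y = (if 0 \<le> y \<and> y < X x then 1 else 0)" for x y
  have h: "case_prod h \<in> borel_measurable (M \<Otimes>\<^sub>M lborel)"
    unfolding h_def[abs_def] by measurable
  have h': "(\<lambda>(y, x). h x y) \<in> borel_measurable (lborel \<Otimes>\<^sub>M M)"
    unfolding h_def[abs_def] by measurable
  have tail: "emeasure M {x \<in> space M. y < X x} * indicator {0..} y = (\<integral>\<^sup>+ x. h x y \<partial>M)" for y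
  proof (cases "0 \<le> y")
    case True
    have "(\<integral>\<^sup>+ x. h x y \<partial>M) = (\<integral>\<^sup>+ x. indicator {x \<in> space M. y < X x} x \<partial>M)"
      using True by (intro nn_integral_cong) (auto simp: h_def)
    then show ?thesis using True by simp
  qed (simp add: h_def)
  have "(\<integral>\<^sup>+ x. ennreal (X x) \<partial>M) = (\<integral>\<^sup>+ x. (\<integral>\<^sup>+ y. h x y \<partial>lborel) \<partial>M)"
  proof (intro nn_integral_cong_AE, use nonneg in eventually_elim)
    fix x assume "0 \<le> X x"
    have "(\<integral>\<^sup>+ y. h x y \<partial>lborel) = (\<integral>\<^sup>+ y. indicator {0..<X x} y \<partial>lborel)"
      by (intro nn_integral_cong) (auto simp: h_def)
    also have "\<dots> = ennreal (X x)"
      using \<open>0 \<le> X x\<close> by simp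
    finally show "ennreal (X x) = (\<integral>\<^sup>+ y. h x y \<partial>lborel)" ..
  qed
  also have "\<dots> = (\<integral>\<^sup>+ y. (\<integral>\<^sup>+ x. h x y \<partial>M) \<partial>lborel)"
    using Fubini'[OF h] by simp
  finally show "(\<integral>\<^sup>+ y. emeasure M {x \<in> space M. y < X x} * indicator {0..} y \<partial>lborel) = (\<integral>\<^sup>+ x. ennreal (X x) \<partial>M)"
    by (simp only: tail)
  show "(\<lambda>y. emeasure M {x \<in> space M. y < X x} * indicator {0..} y) \<in> borel_measurable lborel"
    unfolding tail using measurable_integral[OF h'] by simp
qed

text \<open>The form \<open>has_bochner_integral\<close> records integrability along with the value,
  so that instances can be added and scaled termwise.\<close>

lemma (in prob_space) layer_cake:
  fixes X :: "'a \<Rightarrow> real"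
  assumes int: "integrable M X" and nonneg: "AE x in M. 0 \<le> X x"
  shows "has_bochner_integral lborel (\<lambda>y. prob {x \<in> space M. y < X x} * indicator {0..} y) (expectation X)"
proof (rule has_bochner_integral_nn_integral)
  have X: "X \<in> borel_measurable M" using int by simp
  note lc = nn_integral_layer_cake[OF X nonneg]
  have eq: "ennreal (prob {x \<in> space M. y < X x} * indicator {0..} y) =
      emeasure M {x \<in> space M. y < X x} * indicator {0..} y" for y
    by (simp add: emeasure_eq_measure indicator_def)
  have "(\<lambda>y. enn2real (emeasure M {x \<in> space M. y < X x} * indicator {0..} y)) \<in> borel_measurable lborel"
    using lc(1) by measurable
  then show "(\<lambda>y. prob {x \<in> space M. y < X x} * indicator {0..} y) \<in> borel_measurable lborel"
    by (simp flip: eq)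
  show "0 \<le> expectation X"
    using nonneg by (rule integral_nonneg_AE)
  show "(\<integral>\<^sup>+ y. ennreal (prob {x \<in> space M. y < X x} * indicator {0..} y) \<partial>lborel) = ennreal (expectation X)"
    unfolding eq lc(2) by (rule nn_integral_eq_integral[OF int nonneg])
qed auto

section \<open>Running maxima as a bound for the optimum\<close>

text \<open>The selected intervals are disjoint parts of \<open>{1..n}\<close>, since a covered step
  has an empty interval. A step \<open>k\<close> in the interval of \<open>i\<close> earns
  \<open>x i\<close> with \<open>i \<le> k\<close>, at most the running maximum.\<close>

lemma total_value_le_sum_Max:
  assumes x: "\<And>i. i \<in> {1..n} \<Longrightarrow> 0 \<le> x i" and t: "t \<in> feasible n"
  shows "total_value n x t \<le> (\<Sum>k\<in>{1..n}. Max (x ` {1..k}))"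
proof -
  have feas: "if covered t i then t i = 0 else t i \<in> {1..n - i + 1}" if "i \<in> {1..n}" for i
    using t that unfolding feasible_def by blast
  have sub: "{i..<i + t i} \<subseteq> {1..n}" if "i \<in> {1..n}" for i
    using feas[OF that] that by (auto split: if_splits)
  have disj: "{i..<i + t i} \<inter> {j..<j + t j} = {}" if "i \<in> {1..n}" "j \<in> {1..n}" "i < j" for i j
  proof (cases "j < i + t i")
    case True
    then have "covered t j" using that by (auto simp: covered_def)
    then show ?thesis using feas[OF that(2)] by simp
  qed auto
  have disj': "{i..<i + t i} \<inter> {j..<j + t j} = {}" if "i \<in> {1..n}" "j \<in> {1..n}" "i \<noteq> j" for i j
    using that disj[of i j] disj[of j i] by (cases "i < j") auto
  have le: "x i \<le> Max (x ` {1..k})" if "i \<in> {1..n}" "k \<in> {i..<i + t i}" for i k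
    using that by (intro Max_ge) auto
  have "total_value n x t = (\<Sum>i\<in>{1..n}. \<Sum>k\<in>{i..<i + t i}. x i)"
    by (simp add: total_value_def mult.commute)
  also have "\<dots> \<le> (\<Sum>i\<in>{1..n}. \<Sum>k\<in>{i..<i + t i}. Max (x ` {1..k}))"
    by (intro sum_mono le)
  also have "\<dots> = (\<Sum>k\<in>(\<Union>i\<in>{1..n}. {i..<i + t i}). Max (x ` {1..k}))"
    using disj' by (subst sum.UNION_disjoint) auto
  also have "\<dots> \<le> (\<Sum>k\<in>{1..n}. Max (x ` {1..k}))"
  proof (intro sum_mono2)
    fix k assume k: "k \<in> {1..n} - (\<Union>i\<in>{1..n}. {i..<i + t i})"
    then have "0 \<le> x 1" using x[of 1] by simp
    also have "x 1 \<le> Max (x ` {1..k})" using k by (intro Max_ge) auto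
    finally show "0 \<le> Max (x ` {1..k})" .
  next
    show "(\<Union>i\<in>{1..n}. {i..<i + t i}) \<subseteq> {1..n}" using sub by blast
  qed simp
  finally show ?thesis .
qed

lemma opt_le_sum_Max:
  assumes "\<And>i. i \<in> {1..n} \<Longrightarrow> 0 \<le> x i"
  shows "opt n x \<le> (\<Sum>k\<in>{1..n}. Max (x ` {1..k}))"
  unfolding opt_def using total_value_le_sum_Max[OF assms] finite_feasible feasible_nonempty
  by (subst Max_le_iff) auto

lemma onl_le_opt: "onl n \<theta> x \<le> opt n x"
  unfolding opt_def onl_def using onl_choice_feasible finite_feasible by (intro Max_ge) auto

section \<open>Expectations over independent values\<close>

context
  fixes D :: "real measure" and n :: nat
  assumes D: "prophet_dist D"
begin

interpretation real_distribution D
  using D by (simp add: prophet_dist_def)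

interpretation P: product_prob_space "\<lambda>_ :: nat. D" "{1..n}" ..

lemma prob_space_iid: "prob_space (iid n D)"
  by (rule prob_space_PiM) (rule prob_space_axioms)

lemma integrable_id: "integrable D (\<lambda>x. x)"
  using D by (simp add: prophet_dist_def)

text \<open>Strict positivity gives \<open>D\<close> a positive mean, which keeps the denominator of
  the final ratio positive.\<close>

lemma AE_pos: "AE x in D. 0 < x"
proof (rule AE_I)
  show "{x \<in> space D. \<not> 0 < x} \<subseteq> {..0}" by auto
  show "emeasure D {..0} = 0"
    using D by (simp add: prophet_dist_def cdf_def emeasure_eq_measure)
qed simp

lemma AE_nonneg: "AE x in D. 0 \<le> x"
  using AE_pos by eventually_elim simp

lemma prob_greaterThan: "measure D {y<..} = 1 - cdf D y"
proof -
  have "measure D (space D - {..y}) = 1 - measure D {..y}"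
    by (intro prob_compl) simp
  moreover have "space D - {..y} = {y<..}" by auto
  ultimately show ?thesis by (simp add: cdf_def)
qed

lemma AE_iid_nonneg: "AE x in iid n D. \<forall>i\<in>{1..n}. 0 \<le> x i"
proof (intro AE_finite_allI)
  fix i assume "i \<in> {1..n}"
  show "AE x in iid n D. 0 \<le> x i"
    using AE_nonneg by (rule AE_PiM_component[OF prob_space_axioms \<open>i \<in> {1..n}\<close>])
qed simp

lemma integrable_component: "i \<in> {1..n} \<Longrightarrow> integrable (iid n D) (\<lambda>x. x i)"
proof -
  assume i: "i \<in> {1..n}"
  have "distr (iid n D) D (\<lambda>x. x i) = D"
    by (intro distr_PiM_component i prob_space_axioms)
  then have "integrable (distr (iid n D) D (\<lambda>x. x i)) (\<lambda>x. x)"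
    using integrable_id by (simp only:)
  then show "integrable (iid n D) (\<lambda>x. x i)"
    by (rule integrable_distr[OF measurable_component_singleton[OF i]])
qed

lemma measurable_component_real: "i \<in> {1..n} \<Longrightarrow> (\<lambda>x. x i) \<in> borel_measurable (iid n D)"
  using integrable_component by (rule borel_measurable_integrable)

lemma integrable_running_Max:
  assumes "k \<in> {1..n}"
  shows "integrable (iid n D) (\<lambda>x. Max (x ` {1..k}))"
proof (rule Bochner_Integration.integrable_bound)
  show "integrable (iid n D) (\<lambda>x. \<Sum>i\<in>{1..n}. x i)"
    by (intro Bochner_Integration.integrable_sum integrable_component)
  show "(\<lambda>x. Max (x ` {1..k})) \<in> borel_measurable (iid n D)"
    using assms by (intro borel_measurable_Max measurable_component_real) auto
  show "AE x in iid n D. norm (Max (x ` {1..k})) \<le> norm (\<Sum>i\<in>{1..n}. x i)"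
    using AE_iid_nonneg
  proof eventually_elim
    case (elim x)
    have "Max (x ` {1..k}) \<in> x ` {1..k}"
      using assms by (intro Max_in) auto
    then obtain i where "i \<in> {1..k}" and i: "Max (x ` {1..k}) = x i"
      by (rule imageE)
    then have "i \<in> {1..n}" using assms by simp
    then have "x i \<le> (\<Sum>i\<in>{1..n}. x i)"
      using elim by (intro member_le_sum) auto
    then show ?case using elim i \<open>i \<in> {1..n}\<close> by simp
  qed
qed

text \<open>The complementary event is a cylinder on which the first \<open>k\<close> coordinates
  are at most \<open>y\<close>.\<close>

lemma prob_running_Max:
  assumes "k \<in> {1..n}"
  shows "measure (iid n D) {x \<in> space (iid n D). y < Max (x ` {1..k})} = 1 - cdf D y ^ k"
proof -
  let ?A = "prod_emb {1..n} (\<lambda>_. D) {1..k} (\<Pi>\<^sub>E i\<in>{1..k}. {..y})"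
  have "{x \<in> space (iid n D). y < Max (x ` {1..k})} = space (iid n D) - ?A"
  proof -
    have "y < Max (x ` {1..k}) \<longleftrightarrow> \<not> (\<forall>i\<in>{1..k}. x i \<le> y)" for x :: "nat \<Rightarrow> real"
      using assms by (subst Max_gr_iff) (auto simp: not_le)
    then show ?thesis
      by (auto simp: prod_emb_def space_PiM PiE_iff extensional_def)
  qed
  moreover have "?A \<in> sets (iid n D)"
    using assms by (intro sets_PiM_I) auto
  moreover have "measure (iid n D) ?A = (\<Prod>i\<in>{1..k}. measure D {..y})"
    using assms by (intro P.measure_PiM_emb) auto
  ultimately show ?thesis
    using prob_space.prob_compl[OF prob_space_iid, of ?A] by (simp add: cdf_def)
qed

text \<open>The witness \<open>e\<close> is the expected sum of the running maxima, to which the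
  layer-cake formula applies termwise.\<close>

lemma
  shows E_opt_le: "\<exists>e \<ge> E_opt n D. has_bochner_integral lborel (\<lambda>y. opt_tail n (1 - cdf D y) * indicator {0..} y) e"
    and integrable_opt: "integrable (iid n D) (opt n)"
proof -
  let ?S = "\<lambda>x. \<Sum>k\<in>{1..n}. Max (x ` {1..k})"
  have S: "integrable (iid n D) ?S"
    by (intro Bochner_Integration.integrable_sum integrable_running_Max)
  have le: "AE x in iid n D. 0 \<le> opt n x \<and> opt n x \<le> ?S x"
    using AE_iid_nonneg
  proof eventually_elim
    case (elim x)
    \<comment> \<open>The algorithm with zero thresholds serves as a feasible choice of nonnegative
      value, so the optimum is nonnegative.\<close>
    then have "0 \<le> onl n (\<lambda>_. 0) x"
      by (auto simp: onl_def total_value_def intro!: sum_nonneg)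
    then show ?case
      using onl_le_opt[of n "\<lambda>_. 0" x] opt_le_sum_Max[of n x] elim by auto
  qed
  have meas: "opt n \<in> borel_measurable (iid n D)"
    unfolding opt_def[abs_def] total_value_def using finite_feasible
    by (intro borel_measurable_Max borel_measurable_sum borel_measurable_times measurable_component_real) auto
  show int: "integrable (iid n D) (opt n)"
    using S meas by (rule Bochner_Integration.integrable_bound) (use le in eventually_elim, auto)
  have "E_opt n D \<le> integral\<^sup>L (iid n D) ?S"
    unfolding E_opt_def using int S
  proof (rule integral_mono_AE)
    show "AE x in iid n D. opt n x \<le> ?S x"
      using le by eventually_elim simp
  qed
  moreover have "integral\<^sup>L (iid n D) ?S = (\<Sum>k\<in>{1..n}. integral\<^sup>L (iid n D) (\<lambda>x. Max (x ` {1..k})))"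
    by (intro Bochner_Integration.integral_sum integrable_running_Max)
  moreover have "has_bochner_integral lborel
     (\<lambda>y. \<Sum>k\<in>{1..n}. (1 - cdf D y ^ k) * indicator {0..} y)
     (\<Sum>k\<in>{1..n}. integral\<^sup>L (iid n D) (\<lambda>x. Max (x ` {1..k})))"
  proof (intro has_bochner_integral_sum)
    fix k assume k: "k \<in> {1..n}"
    have "AE x in iid n D. 0 \<le> Max (x ` {1..k})"
      using AE_iid_nonneg
    proof eventually_elim
      case (elim x)
      then have "0 \<le> x 1" using k by auto
      also have "x 1 \<le> Max (x ` {1..k})" using k by (intro Max_ge) auto
      finally show ?case .
    qed
    from prob_space.layer_cake[OF prob_space_iid integrable_running_Max[OF k] this]
    show "has_bochner_integral lborel (\<lambda>y. (1 - cdf D y ^ k) * indicator {0..} y)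
        (integral\<^sup>L (iid n D) (\<lambda>x. Max (x ` {1..k})))"
      by (simp only: prob_running_Max[OF k])
  qed
  ultimately show "\<exists>e \<ge> E_opt n D. has_bochner_integral lborel (\<lambda>y. opt_tail n (1 - cdf D y) * indicator {0..} y) e"
    by (auto simp: opt_tail_def sum_distrib_right)
qed

lemma integrable_truncated: "integrable D (\<lambda>x. x * indicator {\<theta><..} x)"
  using integrable_id by (intro integrable_real_mult_indicator) auto

lemma
  shows E_onl_eq: "E_onl n \<theta> D = (\<Sum>i\<in>{1..n}. (\<Prod>j\<in>{1..<i}. cdf D (\<theta> j)) *
      ((real n - i) * integral\<^sup>L D (\<lambda>x. x * indicator {\<theta> i<..} x) + integral\<^sup>L D (\<lambda>x. x)))"
    and integrable_onl: "integrable (iid n D) (onl n \<theta>)"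
proof -
  \<comment> \<open>Writes the gain of step \<open>i\<close> as a product of functions of single
    coordinates: no earlier value stops the algorithm, the value at \<open>i\<close> is collected,
    later values do not matter. Independence then factors the expectation.\<close>
  define f where "f i j x = (if j < i then indicator {..\<theta> j} x
      else if j = i then (real n - i) * (x * indicator {\<theta> i<..} x) + x else 1)" for i j :: nat and x :: real
  have int: "integrable D (f i j)" for i j
  proof -
    consider "j < i" | "j = i" | "j > i" by linarith
    then show ?thesis
    proof cases
      case 1
      then have "f i j = indicator {..\<theta> j}" by (auto simp: f_def)
      then show ?thesis by (simp add: integrable_real_indicator less_top[symmetric])
    next
      case 2
      then have "f i j = (\<lambda>x. (real n - i) * (x * indicator {\<theta> i<..} x) + x)" by (auto simp: f_def)
      then show ?thesis
        using integrable_truncated[of "\<theta> i"] integrable_id by simp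
    next
      case 3
      then have "f i j = (\<lambda>x. 1)" by (auto simp: f_def)
      then show ?thesis by simp
    qed
  qed
  have eq: "x i * real (onl_choice n \<theta> x i) = (\<Prod>j\<in>{1..n}. f i j (x j))" if i: "i \<in> {1..n}" for x i
  proof -
    have "(\<Prod>j\<in>{1..n}. f i j (x j)) = (\<Prod>j\<in>{1..<i}. f i j (x j)) * f i i (x i)"
    proof -
      have "(\<Prod>j\<in>{1..n}. f i j (x j)) = (\<Prod>j\<in>{1..i}. f i j (x j))"
        using i by (intro prod.mono_neutral_right) (auto simp: f_def)
      also have "{1..i} = insert i {1..<i}" using i by auto
      finally show ?thesis by (simp add: mult.commute)
    qed
    also have "(\<Prod>j\<in>{1..<i}. f i j (x j)) = (if \<exists>j\<in>{1..<i}. x j > \<theta> j then 0 else 1)"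
    proof (cases "\<exists>j\<in>{1..<i}. x j > \<theta> j")
      case True
      then obtain j where "j \<in> {1..<i}" "x j > \<theta> j" by blast
      then have "f i j (x j) = 0" by (simp add: f_def)
      with \<open>j \<in> {1..<i}\<close> have "\<exists>j\<in>{1..<i}. f i j (x j) = 0" by blast
      then show ?thesis using True by (simp add: prod_zero)
    next
      case False
      then have "f i j (x j) = 1" if "j \<in> {1..<i}" for j
        using that by (auto simp: f_def not_less)
      then show ?thesis using False by (simp add: prod.neutral)
    qed
    moreover have "real (n - i + 1) = real n - i + 1"
      using i by (simp add: of_nat_diff)
    ultimately show ?thesis
      using i by (auto simp: f_def onl_choice_def indicator_def distrib_left mult.commute)
  qed
  have fact_int: "integrable (iid n D) (\<lambda>x. \<Prod>j\<in>{1..n}. f i j (x j))" for i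
    by (intro P.product_integrable_prod int) simp
  have onl: "onl n \<theta> = (\<lambda>x. \<Sum>i\<in>{1..n}. \<Prod>j\<in>{1..n}. f i j (x j))"
    by (auto simp: onl_def total_value_def eq)
  show "integrable (iid n D) (onl n \<theta>)"
    unfolding onl by (intro Bochner_Integration.integrable_sum fact_int)
  have "E_onl n \<theta> D = (\<Sum>i\<in>{1..n}. \<Prod>j\<in>{1..n}. integral\<^sup>L D (f i j))"
    unfolding E_onl_def onl using fact_int int
    by (simp add: P.product_integral_prod)
  also have "\<dots> = (\<Sum>i\<in>{1..n}. (\<Prod>j\<in>{1..<i}. cdf D (\<theta> j)) *
      ((real n - i) * integral\<^sup>L D (\<lambda>x. x * indicator {\<theta> i<..} x) + integral\<^sup>L D (\<lambda>x. x)))"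
  proof (intro sum.cong refl)
    fix i assume i: "i \<in> {1..n}"
    have "(\<Prod>j\<in>{1..n}. integral\<^sup>L D (f i j)) = (\<Prod>j\<in>{1..i}. integral\<^sup>L D (f i j))"
      using i prob_space by (intro prod.mono_neutral_right) (auto simp: f_def[abs_def])
    also have "{1..i} = insert i {1..<i}" using i by auto
    also have "(\<Prod>j\<in>insert i {1..<i}. integral\<^sup>L D (f i j)) = integral\<^sup>L D (f i i) * (\<Prod>j\<in>{1..<i}. integral\<^sup>L D (f i j))"
      by simp
    also have "(\<Prod>j\<in>{1..<i}. integral\<^sup>L D (f i j)) = (\<Prod>j\<in>{1..<i}. cdf D (\<theta> j))"
      by (intro prod.cong) (auto simp: f_def[abs_def] cdf_def)
    also have "integral\<^sup>L D (f i i) = (real n - i) * integral\<^sup>L D (\<lambda>x. x * indicator {\<theta> i<..} x) + integral\<^sup>L D (\<lambda>x. x)"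
      using integrable_truncated[of "\<theta> i"] integrable_id by (simp add: f_def[abs_def])
    finally show "(\<Prod>j\<in>{1..n}. integral\<^sup>L D (f i j)) = (\<Prod>j\<in>{1..<i}. cdf D (\<theta> j)) *
      ((real n - i) * integral\<^sup>L D (\<lambda>x. x * indicator {\<theta> i<..} x) + integral\<^sup>L D (\<lambda>x. x))"
      by (simp add: mult.commute)
  qed
  finally show "E_onl n \<theta> D = (\<Sum>i\<in>{1..n}. (\<Prod>j\<in>{1..<i}. cdf D (\<theta> j)) *
      ((real n - i) * integral\<^sup>L D (\<lambda>x. x * indicator {\<theta> i<..} x) + integral\<^sup>L D (\<lambda>x. x)))" .
qed

text \<open>For \<open>y \<ge> 0\<close> the truncated value exceeds \<open>y\<close> exactly when
  \<open>x > max y \<theta>\<close>, and the tail probability at a maximum is the minimum of the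
  two.\<close>

lemma layer_cake_truncated:
  "has_bochner_integral lborel (\<lambda>y. min (1 - cdf D y) (1 - cdf D \<theta>) * indicator {0..} y)
     (integral\<^sup>L D (\<lambda>x. x * indicator {\<theta><..} x))"
proof -
  have "AE x in D. 0 \<le> x * indicator {\<theta><..} x"
    using AE_nonneg by eventually_elim simp
  from layer_cake[OF integrable_truncated this]
  have "has_bochner_integral lborel
     (\<lambda>y. measure D {x \<in> space D. y < x * indicator {\<theta><..} x} * indicator {0..} y)
     (integral\<^sup>L D (\<lambda>x. x * indicator {\<theta><..} x))" .
  moreover have "measure D {x \<in> space D. y < x * indicator {\<theta><..} x} * indicator {0..} y =
      min (1 - cdf D y) (1 - cdf D \<theta>) * indicator {0..} y" for y
  proof (cases "0 \<le> y")
    case True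
    then have "y < x * indicator {\<theta><..} x \<longleftrightarrow> max y \<theta> < x" for x
      by (cases "\<theta> < x") simp_all
    then have "{x \<in> space D. y < x * indicator {\<theta><..} x} = {max y \<theta><..}"
      by (simp only: greaterThan_def) simp
    moreover have "measure D {max y \<theta><..} = min (1 - cdf D y) (1 - cdf D \<theta>)"
    proof (cases "y \<le> \<theta>")
      case True
      then show ?thesis
        using cdf_nondecreasing[OF True] by (simp add: prob_greaterThan max_absorb2 min_absorb2)
    next
      case False
      then have "\<theta> \<le> y" by simp
      then show ?thesis
        using cdf_nondecreasing[OF \<open>\<theta> \<le> y\<close>] by (simp add: prob_greaterThan max_absorb1 min_absorb1)
    qed
    ultimately show ?thesis by simp
  qed simp
  ultimately show ?thesis by (simp only:)
qed

lemma layer_cake_id: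
  "has_bochner_integral lborel (\<lambda>y. (1 - cdf D y) * indicator {0..} y) (integral\<^sup>L D (\<lambda>x. x))"
proof -
  have "measure D {x \<in> space D. y < x} = 1 - cdf D y" for y
    using prob_greaterThan[of y] by (simp add: greaterThan_def)
  then show ?thesis
    using layer_cake[OF integrable_id AE_nonneg] by simp
qed

section \<open>The competitive ratio\<close>

lemma ratio_ge:
  assumes \<delta>: "quantile_selection \<delta>" and n: "n \<ge> 100000"
  shows "0.598 \<le> E_onl n (\<lambda>i. \<delta> D (level 9.71 n i)) D / E_opt n D"
proof -
  define \<theta> where "\<theta> i = \<delta> D (level 9.71 n i)" for i
  \<comment> \<open>For \<open>i \<ge> 1\<close> and \<open>n > 0\<close> the level lies strictly
    between 0 and 1, where \<open>quantile_selection\<close> fixes the cdf.\<close>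
  have \<theta>: "cdf D (\<theta> i) = level 9.71 n i" if "i \<ge> 1" for i
    using \<delta> D that n by (simp add: quantile_selection_def \<theta>_def level_def)
  have "(\<Prod>j\<in>{1..<i}. cdf D (\<theta> j)) = reach 9.71 n i" if "i \<ge> 1" for i
    using prod_level[OF that, of "9.71" n] \<theta> by simp
  then have onl: "E_onl n \<theta> D = (\<Sum>i\<in>{1..n}. reach 9.71 n i *
      ((real n - i) * integral\<^sup>L D (\<lambda>x. x * indicator {\<theta> i<..} x) + integral\<^sup>L D (\<lambda>x. x)))"
    by (simp add: E_onl_eq)
  have "has_bochner_integral lborel (\<lambda>y. \<Sum>i\<in>{1..n}. reach 9.71 n i *
      ((real n - i) * (min (1 - cdf D y) (1 - cdf D (\<theta> i)) * indicator {0..} y) + (1 - cdf D y) * indicator {0..} y))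
     (E_onl n \<theta> D)"
    unfolding onl
    by (intro has_bochner_integral_sum has_bochner_integral_mult_right has_bochner_integral_add
      layer_cake_id layer_cake_truncated)
  also have "(\<lambda>y. \<Sum>i\<in>{1..n}. reach 9.71 n i *
      ((real n - i) * (min (1 - cdf D y) (1 - cdf D (\<theta> i)) * indicator {0..} y) + (1 - cdf D y) * indicator {0..} y)) =
     (\<lambda>y. onl_tail n (1 - cdf D y) * indicator {0..} y)"
  proof
    fix y
    show "(\<Sum>i\<in>{1..n}. reach 9.71 n i * ((real n - i) *
        (min (1 - cdf D y) (1 - cdf D (\<theta> i)) * indicator {0..} y) + (1 - cdf D y) * indicator {0..} y)) =
      onl_tail n (1 - cdf D y) * indicator {0..} y"
      unfolding onl_tail_def sum_distrib_right
      by (intro sum.cong refl) (simp add: \<theta> indicator_def)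
  qed
  finally have G: "has_bochner_integral lborel (\<lambda>y. onl_tail n (1 - cdf D y) * indicator {0..} y) (E_onl n \<theta> D)" .
  obtain e where e: "E_opt n D \<le> e"
    "has_bochner_integral lborel (\<lambda>y. opt_tail n (1 - cdf D y) * indicator {0..} y) e"
    using E_opt_le by blast
  have "0.598 * e \<le> E_onl n \<theta> D"
  proof -
    have pointwise: "0.598 * (opt_tail n (1 - cdf D y) * indicator {0..} y) \<le> onl_tail n (1 - cdf D y) * indicator {0..} y" for y
      using tail_bound[OF n, of "1 - cdf D y"] cdf_nonneg[of y] cdf_bounded_prob[of y]
      by (simp add: indicator_def)
    have "has_bochner_integral lborel (\<lambda>y. 0.598 * (opt_tail n (1 - cdf D y) * indicator {0..} y)) (0.598 * e)"
      by (intro has_bochner_integral_mult_right e(2))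
    then have "0.598 * e = (LBINT y. 0.598 * (opt_tail n (1 - cdf D y) * indicator {0..} y))"
      "integrable lborel (\<lambda>y. 0.598 * (opt_tail n (1 - cdf D y) * indicator {0..} y))"
      by (simp_all only: has_bochner_integral_iff)
    moreover have "E_onl n \<theta> D = (LBINT y. onl_tail n (1 - cdf D y) * indicator {0..} y)"
      "integrable lborel (\<lambda>y. onl_tail n (1 - cdf D y) * indicator {0..} y)"
      using G by (simp_all only: has_bochner_integral_iff)
    ultimately show ?thesis
      using integral_mono[OF _ _ pointwise] by simp
  qed
  then have le: "0.598 * E_opt n D \<le> E_onl n \<theta> D"
    using e(1) by simp
  \<comment> \<open>Dividing by \<open>E_opt n D\<close> requires it to be positive; it is at least
    \<open>E_onl n \<theta> D\<close>, whose summands are positive by the mean of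
    \<open>D\<close>.\<close>
  have "0 < E_onl n \<theta> D"
    unfolding onl
  proof (intro sum_pos mult_pos_pos add_nonneg_pos mult_nonneg_nonneg)
    show "0 < integral\<^sup>L D (\<lambda>x. x)"
      by (intro expectation_greater integrable_id AE_pos)
    show "0 \<le> integral\<^sup>L D (\<lambda>x. x * indicator {\<theta> i<..} x)" for i
    proof (rule integral_nonneg_AE)
      show "AE x in D. 0 \<le> x * indicator {\<theta> i<..} x"
        using AE_nonneg by eventually_elim simp
    qed
  qed (use n in \<open>auto simp: reach_def\<close>)
  also have "E_onl n \<theta> D \<le> E_opt n D"
    unfolding E_onl_def E_opt_def
    by (intro integral_mono integrable_onl integrable_opt onl_le_opt)
  finally show ?thesis
    using le unfolding \<theta>_def[abs_def] by (simp add: pos_le_divide_eq)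
qed

end

theorem theorem4:
  fixes \<delta> :: "real measure \<Rightarrow> real \<Rightarrow> real" and c :: real
  assumes "quantile_selection \<delta>"
    and "c = 9.71"
  shows "liminf (\<lambda>n. INF D\<in>{D. prophet_dist D}.
           ereal (E_onl n (\<lambda>i. \<delta> D (level c n i)) D / E_opt n D)) \<ge> ereal 0.598"
proof (rule Liminf_bounded, rule eventually_sequentiallyI)
  \<comment> \<open>The bound on \<open>n\<close> does not depend on \<open>D\<close>, so the
    estimate passes to the infimum.\<close>
  fix n :: nat assume "n \<ge> 100000"
  then show "ereal 0.598 \<le> (INF D\<in>{D. prophet_dist D}.
      ereal (E_onl n (\<lambda>i. \<delta> D (level c n i)) D / E_opt n D))"
    unfolding assms(2) using ratio_ge[OF _ assms(1)] by (intro INF_greatest) simp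
qed

end
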